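(* For the torus of size $n\ge 3$, the normalizing factor satisfies $Z<\left(4\ln(n/2)\right)^{-1}$.
   Context: Let $n\ge 3$, $[\![n]\!]=\{0,1,\dots,n-1\}$, and let $T$ be the two-dimensional undirected torus with vertex set $V=[\![n]\!]^2$, where $(i,j)$ is adjacent to $(i,(j+1)\bmod n)$ and $((i+1)\bmod n,j)$. For $u=(x_u,y_u),v=(x_v,y_v)\in V$, $d_{uv}=\min(|x_u-x_v|,n-|x_u-x_v|)+\min(|y_u-y_v|,n-|y_u-y_v|)$. The normalizing factor is $Z=\left(\sum_{v\in V\setminus\{u\}} d_{uv}^{-2}\right)^{-1}$ for any $u\in V$ (its value does not depend on $u$). $\ln$ denotes the natural logarithm. *)

theory Defs
  imports Complex_Main
begin

(* Coordinates are integers, so that the differences in the distance do not truncate. *)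

definition torus_verts :: "nat \<Rightarrow> (int \<times> int) set" where
  "torus_verts n = {0..<int n} \<times> {0..<int n}"

definition cyclic_dist :: "nat \<Rightarrow> int \<Rightarrow> int \<Rightarrow> int" where
  "cyclic_dist n a b = min \<bar>a - b\<bar> (int n - \<bar>a - b\<bar>)"

definition torus_dist :: "nat \<Rightarrow> int \<times> int \<Rightarrow> int \<times> int \<Rightarrow> int" where
  "torus_dist n u v = cyclic_dist n (fst u) (fst v) + cyclic_dist n (snd u) (snd v)"

(* On the vertices, the value does not depend on the base vertex u. *)

definition normalizing_factor :: "nat \<Rightarrow> int \<times> int \<Rightarrow> real" where
  "normalizing_factor n u =
     inverse (\<Sum>v\<in>torus_verts n - {u}. real_of_int (torus_dist n u v) powi (-2))"

end

theory Submission
  imports Defs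
begin

text \<open>
  Put \<open>k = (n - 1) div 2\<close>. For \<open>1 \<le> d \<le> k\<close> the torus does not wrap around at distance \<open>d\<close>, so the
  sphere of radius \<open>d\<close> is a sphere of the \<open>l\<^sub>1\<close>-metric on the integer lattice, with \<open>4 d\<close> points.
  These spheres alone contribute four times the \<open>k\<close>-th harmonic number to the sum, which exceeds
  \<open>4 ln (k + 1) \<ge> 4 ln (n / 2)\<close>.
\<close>

definition lattice_sphere :: "int \<Rightarrow> (int \<times> int) set" where
  "lattice_sphere d = {(a, b). \<bar>a\<bar> + \<bar>b\<bar> = d}"

lemma finite_lattice_sphere: "finite (lattice_sphere d)"
  by (rule finite_subset[of _ "{-d..d} \<times> {-d..d}"]) (auto simp: lattice_sphere_def)

lemma card_lattice_sphere_ge: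
  assumes "d > 0"
  shows "4 * d \<le> int (card (lattice_sphere d))"
proof -
  \<comment> \<open>\<open>?f\<close> runs along the half of the sphere with b \<ge> 0 and
    \<open>?g\<close> is its negation. Leaving out a = - d makes \<open>?f\<close> meet the axis b =
    0 only in (d, 0) and \<open>?g\<close> only in (- d, 0), so the halves are disjoint with 2 d
    points each.\<close>
  let ?I = "{1 - d..d}"
  let ?f = "\<lambda>a. (a, d - \<bar>a\<bar>)" and ?g = "\<lambda>a. (- a, \<bar>a\<bar> - d)"
  have "card (?f ` ?I) = nat (2 * d)" "card (?g ` ?I) = nat (2 * d)"
    by (subst card_image; simp add: inj_on_def)+
  moreover have "?f ` ?I \<inter> ?g ` ?I = {}"
    using assms by auto
  ultimately have "card (?f ` ?I \<union> ?g ` ?I) = nat (4 * d)"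
    using assms by (subst card_Un_disjoint) auto
  moreover have "?f ` ?I \<union> ?g ` ?I \<subseteq> lattice_sphere d"
    by (auto simp: lattice_sphere_def)
  ultimately show ?thesis
    using card_mono[OF finite_lattice_sphere, of "?f ` ?I \<union> ?g ` ?I" d] assms by linarith
qed

text \<open>Reduction modulo n shifts x + a by n, 0 or - n. After a wrap the coordinates differ by n
  - \<bar>a\<bar>, so the two arguments of the minimum swap; as 2 \<bar>a\<bar> < n, the smaller one
  is always \<bar>a\<bar>.\<close>

lemma cyclic_dist_translate:
  assumes "0 \<le> x" "x < int n" "2 * \<bar>a\<bar> < int n"
  shows "cyclic_dist n x ((x + a) mod int n) = \<bar>a\<bar>"
proof -
  consider "x + a < 0" | "0 \<le> x + a" "x + a < int n" | "int n \<le> x + a"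
    by linarith
  then show ?thesis
  proof cases
    case 1
    have "(x + a) mod int n = (x + a + int n) mod int n" by simp
    also have "\<dots> = x + a + int n"
      using 1 assms by (intro mod_pos_pos_trivial) linarith+
    finally show ?thesis using 1 assms by (simp add: cyclic_dist_def)
  next
    case 2
    then have "(x + a) mod int n = x + a" by (intro mod_pos_pos_trivial)
    then show ?thesis using assms by (simp add: cyclic_dist_def)
  next
    case 3
    have "(x + a) mod int n = (x + a - int n) mod int n" by simp
    also have "\<dots> = x + a - int n"
      using 3 assms by (intro mod_pos_pos_trivial) linarith+
    finally show ?thesis using 3 assms by (simp add: cyclic_dist_def)
  qed
qed

text \<open>Two offsets below m/2 in absolute value differ by less than m, and the only such
  multiple of m is 0.\<close>

lemma translate_mod_inject:
  fixes x a a' m :: int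
  assumes "(x + a) mod m = (x + a') mod m" "2 * \<bar>a\<bar> < m" "2 * \<bar>a'\<bar> < m"
  shows "a = a'"
proof (rule ccontr)
  assume "a \<noteq> a'"
  moreover have "m dvd a - a'"
    using assms(1) by (simp add: mod_eq_dvd_iff)
  ultimately have "\<bar>m\<bar> \<le> \<bar>a - a'\<bar>"
    by (intro dvd_imp_le_int) auto
  then show False using assms by linarith
qed

text \<open>Translating the lattice sphere to \<open>u\<close> and reducing modulo n embeds it into
  the torus sphere: 2 d < n keeps both offsets below n/2, so distances survive and no two points
  merge.\<close>

lemma card_torus_sphere_ge:
  assumes "u \<in> torus_verts n" "d > 0" "2 * d < int n"
  shows "4 * d \<le> int (card {v \<in> torus_verts n - {u}. torus_dist n u v = d})"
    (is "_ \<le> int (card ?D)")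
proof -
  let ?t = "\<lambda>(a, b). ((fst u + a) mod int n, (snd u + b) mod int n)"
  have u: "0 \<le> fst u" "fst u < int n" "0 \<le> snd u" "snd u < int n"
    using assms(1) by (auto simp: torus_verts_def)
  have "inj_on ?t (lattice_sphere d)"
  proof (rule inj_onI)
    fix p q assume p: "p \<in> lattice_sphere d" and q: "q \<in> lattice_sphere d" and eq: "?t p = ?t q"
    obtain a b a' b' where pq: "p = (a, b)" "q = (a', b')" by fastforce
    have "a = a'"
      by (rule translate_mod_inject[of "fst u" _ "int n"])
        (use p q eq pq assms in \<open>auto simp: lattice_sphere_def\<close>)
    moreover have "b = b'"
      by (rule translate_mod_inject[of "snd u" _ "int n"])
        (use p q eq pq assms in \<open>auto simp: lattice_sphere_def\<close>)
    ultimately show "p = q" using pq by simp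
  qed
  moreover have "?t ` lattice_sphere d \<subseteq> ?D"
  proof
    fix v assume "v \<in> ?t ` lattice_sphere d"
    then obtain a b where ab: "\<bar>a\<bar> + \<bar>b\<bar> = d" and v: "v = ?t (a, b)"
      by (auto simp: lattice_sphere_def)
    have "torus_dist n u v = d"
      using ab v u assms by (simp add: torus_dist_def cyclic_dist_translate)
    moreover have "torus_dist n u u = 0"
      by (simp add: torus_dist_def cyclic_dist_def)
    moreover have "v \<in> torus_verts n"
      using v u by (simp add: torus_verts_def)
    \<comment> \<open>Since d > 0, distance d from \<open>u\<close> also rules out v = u.\<close>
    ultimately show "v \<in> ?D" using assms by auto
  qed
  moreover have "finite ?D"
    by (simp add: torus_verts_def)
  ultimately have "card (lattice_sphere d) \<le> card ?D"
    by (intro card_inj_on_le)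
  then show ?thesis
    using card_lattice_sphere_ge[OF assms(2)] by linarith
qed

text \<open>The logarithm telescopes into increments ln (1 + 1/d), each strictly below 1/d.\<close>

lemma ln_Suc_less_harmonic:
  assumes "k \<ge> 1"
  shows "ln (real (k + 1)) < (\<Sum>d=1..k. 1 / real d)"
proof -
  have step: "ln (real (d + 1)) - ln (real d) < 1 / real d" if "d \<ge> 1" for d
  proof -
    have "ln (real (d + 1)) - ln (real d) = ln (real (d + 1) / real d)"
      using that by (simp add: ln_div)
    also have "real (d + 1) / real d = 1 + 1 / real d"
      using that by (simp add: field_simps)
    also have "ln \<dots> < 1 / real d"
      using that by (intro ln_add_one_self_less_self) simp
    finally show ?thesis .
  qed
  have "ln (real (k + 1)) = (\<Sum>d=1..k. ln (real (d + 1)) - ln (real d))"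
    using sum_Suc_diff[of 1 k "\<lambda>d. ln (real d)"] assms by simp
  also have "\<dots> < (\<Sum>d=1..k. 1 / real d)"
    using assms by (intro sum_strict_mono step) auto
  finally show ?thesis .
qed

lemma harmonic_le_torus_sum:
  assumes "u \<in> torus_verts n" "2 * k < n"
  shows "4 * (\<Sum>d=1..k. 1 / real d)
    \<le> (\<Sum>v\<in>torus_verts n - {u}. real_of_int (torus_dist n u v) powi (-2))"
proof -
  let ?V = "torus_verts n - {u}" and ?w = "\<lambda>v. real_of_int (torus_dist n u v) powi (-2)"
  define D where "D d = {v \<in> ?V. torus_dist n u v = int d}" for d
  have fin: "finite ?V" "finite (D d)" for d
    by (auto simp: torus_verts_def D_def)
  have "4 * (\<Sum>d=1..k. 1 / real d) = (\<Sum>d=1..k. 4 * (1 / real d))"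
    by (rule sum_distrib_left)
  also have "\<dots> \<le> (\<Sum>d=1..k. \<Sum>v\<in>D d. ?w v)"
  proof (rule sum_mono)
    fix d assume d: "d \<in> {1..k}"
    have "4 * int d \<le> int (card (D d))"
      unfolding D_def using d assms by (intro card_torus_sphere_ge) auto
    then have "4 * d \<le> card (D d)" by linarith
    then have card: "4 * real d \<le> real (card (D d))"
      by (metis of_nat_le_iff of_nat_mult of_nat_numeral)
    have "4 * (1 / real d) = (4 * real d) * real d powi (-2)"
      using d by (simp add: power_int_minus field_simps power2_eq_square)
    also have "\<dots> \<le> real (card (D d)) * real d powi (-2)"
      by (rule mult_right_mono[OF card]) simp
    also have "\<dots> = (\<Sum>v\<in>D d. ?w v)"
      by (simp add: D_def)
    finally show "4 * (1 / real d) \<le> (\<Sum>v\<in>D d. ?w v)" .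
  qed
  \<comment> \<open>Spheres of different radii are disjoint.\<close>
  also have "\<dots> = sum ?w (\<Union>d\<in>{1..k}. D d)"
    using fin by (subst sum.UNION_disjoint) (auto simp: D_def)
  \<comment> \<open>The vertices farther away than k add only nonnegative terms.\<close>
  also have "\<dots> \<le> sum ?w ?V"
    by (rule sum_mono2[OF fin(1)]) (auto simp: D_def power_int_minus)
  finally show ?thesis .
qed

theorem theorem6:
  fixes n :: nat and u :: "int \<times> int"
  assumes "n \<ge> 3" and "u \<in> torus_verts n"
  shows "normalizing_factor n u < inverse (4 * ln (real n / 2))"
proof -
  define k where "k = (n - 1) div 2"
  \<comment> \<open>k is the largest radius with 2 k < n; the third bound is an equality for even
    n.\<close>
  have k: "k \<ge> 1" "2 * k < n" "n \<le> 2 * (k + 1)"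
    using assms(1) by (auto simp: k_def)
  have "real n / 2 \<le> real (k + 1)"
    using of_nat_mono[OF k(3), where 'a = real] by simp
  then have "ln (real n / 2) \<le> ln (real (k + 1))"
    using assms(1) by (subst ln_le_cancel_iff) auto
  also have "\<dots> < (\<Sum>d=1..k. 1 / real d)"
    by (rule ln_Suc_less_harmonic[OF k(1)])
  finally have "4 * ln (real n / 2)
      < (\<Sum>v\<in>torus_verts n - {u}. real_of_int (torus_dist n u v) powi (-2))"
    using harmonic_le_torus_sum[OF assms(2) k(2)] by linarith
  \<comment> \<open>Inversion reverses the inequality because the smaller side is positive: n \<ge>
    3 gives n/2 > 1.\<close>
  moreover have "4 * ln (real n / 2) > 0"
    using assms(1) by simp
  ultimately show ?thesis
    unfolding normalizing_factor_def by (rule less_imp_inverse_less)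
qed

end
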